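(* Fix a real number $\alpha\geq 0$. For every integer $n\geq 1$, let $(\lambda_1,\dots,\lambda_n)$ be a random vector with $\lambda_1\geq\lambda_2\geq\dots\geq\lambda_n\geq 0$ whose joint probability density on this region is $$\frac{1}{Z_{n,\alpha}}\exp\left(-\sum_{i=1}^n\lambda_i\right)\prod_{i=1}^n\lambda_i^{\alpha}\prod_{1\leq i<j\leq n}(\lambda_i-\lambda_j)^2,$$ where $Z_{n,\alpha}$ is the normalizing constant, and define $$C_\alpha(n)=\frac{1}{n^{3/2}}\,\mathbb{E}\left[\sum_{i=1}^n\lambda_i^{1/2}\right].$$ Then for all integers $n\geq 1$, $$C_\alpha(n+1)<C_\alpha(n).$$
   Context: The density in the claim is the joint eigenvalue density of the Laguerre unitary ensemble with parameter $\alpha$; it is well defined for every real $\alpha\geq 0$. When $\alpha=m-n$ is a non-negative integer, it is the joint density of the ordered eigenvalues of the complex Wishart matrix $XX^*$, where $X$ is an $n\times m$ matrix ($m\geq n$) with i.i.d. standard complex normal $\mathcal{CN}(0,1)$ entries. In that case $\lambda_i^{1/2}=\sigma_i(X)$ are the singular values of $X$, and $C_\alpha(n)=n^{-3/2}\,\mathbb{E}\left[\sum_{i=1}^n\sigma_i(X)\right]$. For non-integer $\alpha\geq 0$, $C_\alpha(n)$ is defined by the fractional moment of order $1/2$ of the density, as in the claim. The parameter $\alpha$ is held fixed as $n$ varies. *)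

theory Defs
  imports "HOL-Probability.Probability"
begin

text \<open>
  A point of \<open>n\<close>-space is a function on \<open>{1..n}\<close>, and Lebesgue measure on \<open>n\<close>-space is the
  product measure below, so that \<open>n\<close> may vary inside a formula.
\<close>

abbreviation lebesgue_n :: "nat \<Rightarrow> (nat \<Rightarrow> real) measure" where
  "lebesgue_n n \<equiv> Pi\<^sub>M {1..n} (\<lambda>_. lborel)"

definition ordered_region :: "nat \<Rightarrow> (nat \<Rightarrow> real) set" where
  "ordered_region n =
     {x. (\<forall>i\<in>{1..n}. \<forall>j\<in>{1..n}. i \<le> j \<longrightarrow> x j \<le> x i) \<and> (\<forall>i\<in>{1..n}. 0 \<le> x i)}"

text \<open>
  The unnormalized density, extended by 0 outside the ordered region. For \<open>\<alpha> = 0\<close> the convention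
  \<open>0 powr 0 = 0\<close> changes the weight only where some coordinate vanishes, which is a null set.
\<close>

definition lue_weight :: "real \<Rightarrow> nat \<Rightarrow> (nat \<Rightarrow> real) \<Rightarrow> real" where
  "lue_weight \<alpha> n x =
     indicator (ordered_region n) x *
     (exp (- (\<Sum>i=1..n. x i)) * (\<Prod>i=1..n. x i powr \<alpha>) *
      (\<Prod>i=1..n. \<Prod>j=i+1..n. (x i - x j)\<^sup>2))"

definition lue_Z :: "real \<Rightarrow> nat \<Rightarrow> real" where
  "lue_Z \<alpha> n = (\<integral>x. lue_weight \<alpha> n x \<partial>lebesgue_n n)"

definition lue_density :: "real \<Rightarrow> nat \<Rightarrow> (nat \<Rightarrow> real) \<Rightarrow> real" where
  "lue_density \<alpha> n x = lue_weight \<alpha> n x / lue_Z \<alpha> n"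

definition lue :: "real \<Rightarrow> nat \<Rightarrow> (nat \<Rightarrow> real) measure" where
  "lue \<alpha> n = density (lebesgue_n n) (\<lambda>x. ennreal (lue_density \<alpha> n x))"

text \<open>The expectation is taken under the law of the vector, hence for its canonical realization.\<close>

definition C :: "real \<Rightarrow> nat \<Rightarrow> real" where
  "C \<alpha> n = 1 / real n powr (3 / 2) * (\<integral>x. (\<Sum>i=1..n. sqrt (x i)) \<partial>lue \<alpha> n)"

text \<open>Any random vector with this density, on any measure space, gives the same value.\<close>

lemma C_eq_expectation:
  assumes "distributed M (lebesgue_n n) X (\<lambda>x. ennreal (lue_density \<alpha> n x))"
  shows "C \<alpha> n = 1 / real n powr (3 / 2) * (\<integral>\<omega>. (\<Sum>i=1..n. sqrt (X \<omega> i)) \<partial>M)"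
proof -
  have X: "X \<in> measurable M (lebesgue_n n)"
    using assms by (simp add: distributed_def)
  have law: "lue \<alpha> n = distr M (lebesgue_n n) X"
    using assms by (simp add: distributed_def lue_def)
  have f: "(\<lambda>x. \<Sum>i=1..n. sqrt (x i)) \<in> borel_measurable (lebesgue_n n)"
    by measurable
  show ?thesis
    unfolding C_def law integral_distr[OF X f] ..
qed

end

theory Submission
  imports Defs "Jordan_Normal_Form.Determinant"
begin

hide_const (open) Finite_Cartesian_Product.mat Determinants.det Module.smult

text \<open>
  Let \<open>M(n)\<close> be the expectation of \<open>\<Sum>\<^sub>i \<lambda>\<^sub>i\<^sup>s\<close>. Since the squared Vandermonde determinant is the squared
  determinant of the monic Laguerre polynomials \<open>p\<^sub>i(x\<^sub>j)\<close>, orthogonality gives \<open>M(n) = \<Sum>\<^sub>k\<^sub><\<^sub>n a\<^sub>k\<close> with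
  \<open>a\<^sub>k = \<integral> x\<^sup>s p\<^sub>k\<^sup>2 w / \<integral> p\<^sub>k\<^sup>2 w\<close>. Integration by parts together with the three-term recurrence turns
  this into a discrete Euler equation,
  \<open>n (n + \<alpha>) (M(n+1) - 2 M(n) + M(n-1)) = s (s + 1) M(n)\<close> with \<open>M(0) = 0\<close>.
  For \<open>s = 1/2\<close> the right-hand side is \<open>3/4 M(n)\<close>, and \<open>n\<^bsup>3/2\<^esup>\<close> is a supersolution for every \<open>\<alpha> \<ge> 0\<close> because
  \<open>(1 + h)\<^bsup>3/2\<^esup> + (1 - h)\<^bsup>3/2\<^esup> \<ge> 2 + 3/4 h\<^sup>2\<close>. Hence \<open>M(n+1) / M(n) < (1 + 1/n)\<^bsup>3/2\<^esup>\<close> by induction.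
\<close>

section \<open>The discrete Euler equation\<close>

text \<open>With u = sqrt (1 + h), v = sqrt (1 - h) and q = u + v, the relation u^2 + v^2 = 2 makes
  both sides polynomials in q. Their difference is (q - 2)^2 (3 q^2 + 4 q - 8) / 16, with a double
  root at q = 2, that is, h = 0.\<close>

lemma powr_three_halves_midpoint:
  fixes h :: real
  assumes "0 \<le> h" "h \<le> 1"
  shows "2 + 3 / 4 * h\<^sup>2 \<le> (1 + h) powr (3 / 2) + (1 - h) powr (3 / 2)"
proof -
  have cube: "t powr (3 / 2) = sqrt t ^ 3" if "t \<ge> 0" for t :: real
  proof (cases "t = 0")
    case False
    with that have "t powr (3 / 2) = (t powr (1 / 2)) ^ 3"
      by (simp add: powr_power)
    with that show ?thesis by (simp add: powr_half_sqrt)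
  qed simp
  define u v where "u = sqrt (1 + h)" and "v = sqrt (1 - h)"
  define q where "q = u + v"
  have u: "u\<^sup>2 = 1 + h" "u \<ge> 0" and v: "v\<^sup>2 = 1 - h" "v \<ge> 0"
    using assms by (auto simp: u_def v_def)
  have "q\<^sup>2 = 2 + 2 * (u * v)" using u v by (simp add: q_def power2_sum)
  then have "q\<^sup>2 \<ge> 2" using u v by simp
  moreover have "q \<ge> 0" using u v by (simp add: q_def)
  ultimately have q1: "q \<ge> 1" by (smt (verit) power2_eq_square mult_le_one)
  \<comment> \<open>From q^2 \<ge> 2 and q \<ge> 1 the second factor is at least 6 + 4 - 8 >
    0.\<close>
  have "0 \<le> (q - 2)\<^sup>2 * (3 * q\<^sup>2 + 4 * q - 8)"
    using \<open>q\<^sup>2 \<ge> 2\<close> q1 by (intro mult_nonneg_nonneg) auto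
  also have "\<dots> = 48 * q - 8 * q ^ 3 - 44 + 3 * (q\<^sup>2 - 2)\<^sup>2"
    by (simp add: algebra_simps power2_eq_square power3_eq_cube)
  also have "(q\<^sup>2 - 2)\<^sup>2 = 4 * (u * v)\<^sup>2"
    using \<open>q\<^sup>2 = 2 + 2 * (u * v)\<close> by (simp add: power_mult_distrib)
  finally have key: "2 + 3 / 4 * (1 - (u * v)\<^sup>2) \<le> 3 * q - q ^ 3 / 2"
    by (simp add: field_simps)
  have "(u * v)\<^sup>2 = 1 - h\<^sup>2"
    using u v by (simp only: power_mult_distrib) (simp add: algebra_simps power2_eq_square)
  moreover have "3 * q - q ^ 3 / 2 = u ^ 3 + v ^ 3"
  proof -
    have "6 * q - q ^ 3 = 2 * (u ^ 3 + v ^ 3) + 3 * q * (2 - (u\<^sup>2 + v\<^sup>2))"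
      by (simp add: q_def algebra_simps power2_eq_square power3_eq_cube)
    then show ?thesis using u v by simp
  qed
  ultimately have "2 + 3 / 4 * h\<^sup>2 \<le> u ^ 3 + v ^ 3"
    using key by simp
  then show ?thesis
    using assms by (simp add: cube u_def v_def)
qed

text \<open>An upper bound on the ratio M(n) / M(n-1) is a lower bound on M(n-1), which the
  recurrence turns into an upper bound on M(n+1); this drives an induction on consecutive
  ratios.\<close>

lemma discrete_euler_ratio_decreasing:
  fixes M :: "nat \<Rightarrow> real" and \<alpha> :: real
  assumes \<alpha>: "\<alpha> \<ge> 0" and M0: "M 0 = 0" and pos: "\<And>n. n \<ge> 1 \<Longrightarrow> M n > 0"
    and rec: "\<And>n. n \<ge> 1 \<Longrightarrow>
      real n * (real n + \<alpha>) * (M (n + 1) - 2 * M n + M (n - 1)) = 3 / 4 * M n"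
    and "n \<ge> 1"
  shows "M (n + 1) / real (n + 1) powr (3 / 2) < M n / real n powr (3 / 2)"
proof -
  \<comment> \<open>Positivity of M and \<alpha> \<ge> 0 allow n (n + \<alpha>) to be replaced by
    n^2, which removes \<alpha> from the rest of the argument.\<close>
  have step: "M (n + 1) \<le> (2 + 3 / 4 * (1 / real n)\<^sup>2) * M n - M (n - 1)" if n: "n \<ge> 1" for n
  proof -
    have p: "real n * (real n + \<alpha>) > 0" using n \<alpha> by (intro mult_pos_pos) auto
    have "M (n + 1) - 2 * M n + M (n - 1) = 3 / 4 * M n / (real n * (real n + \<alpha>))"
      using rec[OF n] p by (metis less_numeral_extra(3) nonzero_mult_div_cancel_left)
    also have "\<dots> \<le> 3 / 4 * M n / (real n * real n)"
      using n \<alpha> pos[OF n] by (intro divide_left_mono mult_left_mono mult_pos_pos) auto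
    finally show ?thesis by (simp add: power2_eq_square algebra_simps)
  qed
  have ratio: "M (n + 1) < (1 + 1 / real n) powr (3 / 2) * M n" if "n \<ge> 1" for n
    using that
  proof (induction n rule: nat_induct_at_least)
    case base
    \<comment> \<open>M(0) = 0 gives M(2) \<le> 11/4 M(1), so the base case amounts to 11/4 < 2 sqrt
      2.\<close>
    have "(11 / 8 :: real) < sqrt 2"
      by (rule real_less_rsqrt) (simp add: power2_eq_square)
    moreover have "(2::real) powr (3 / 2) = 2 * sqrt 2"
      using powr_add[of "2::real" 1 "1 / 2"] by (simp add: powr_half_sqrt)
    ultimately have "(11 / 4 :: real) < 2 powr (3 / 2)" by simp
    then have "11 / 4 * M 1 < 2 powr (3 / 2) * M 1" using pos[of 1] by simp
    with step[of 1] M0 show ?case by simp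
  next
    case (Suc n)
    define N where "N = Suc n"
    have N: "N \<ge> 1" "real N > 1" using Suc by (auto simp: N_def)
    have "M N < (1 + 1 / real n) powr (3 / 2) * M n" using Suc by (simp add: N_def)
    then have "(1 - 1 / real N) powr (3 / 2) * M N
        < (1 - 1 / real N) powr (3 / 2) * ((1 + 1 / real n) powr (3 / 2) * M n)"
      using N by (intro mult_strict_left_mono) auto
    also have "\<dots> = ((1 - 1 / real N) * (1 + 1 / real n)) powr (3 / 2) * M n"
      using N by (simp add: powr_mult)
    \<comment> \<open>As N = n + 1, the two factors are reciprocal, which inverts the induction
      hypothesis.\<close>
    also have "(1 - 1 / real N) * (1 + 1 / real n) = 1"
      using Suc.hyps by (simp add: N_def divide_simps)
    finally have "(1 - 1 / real N) powr (3 / 2) * M N < M n" by simp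
    then have "M (N + 1) < (2 + 3 / 4 * (1 / real N)\<^sup>2 - (1 - 1 / real N) powr (3 / 2)) * M N"
      using step[OF N(1)] by (simp add: N_def algebra_simps)
    also have "\<dots> \<le> (1 + 1 / real N) powr (3 / 2) * M N"
      using powr_three_halves_midpoint[of "1 / real N"] N pos[OF N(1)]
      by (intro mult_right_mono) auto
    finally show ?case by (simp add: N_def)
  qed
  have "real (n + 1) powr (3 / 2) = (1 + 1 / real n) powr (3 / 2) * real n powr (3 / 2)"
    using \<open>n \<ge> 1\<close> by (subst powr_mult[symmetric]) (auto simp: distrib_right add.commute)
  then show ?thesis
    using ratio[OF \<open>n \<ge> 1\<close>] \<open>n \<ge> 1\<close> by (simp add: divide_less_eq pos_less_divide_eq field_simps)
qed

section \<open>Monic Laguerre polynomials\<close>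

definition laguerre_weight :: "real \<Rightarrow> real \<Rightarrow> real" where
  "laguerre_weight \<beta> x = indicator {0..} x * x powr \<beta> * exp (- x)"

text \<open>The exponent \<beta> is kept apart from the parameter \<alpha> of the polynomials below:
  orthogonality uses \<beta> = \<alpha>, the moments use \<beta> = \<alpha> + s.\<close>

definition laguerre_functional :: "real \<Rightarrow> real poly \<Rightarrow> real" where
  "laguerre_functional \<beta> p = (\<integral>x. laguerre_weight \<beta> x * poly p x \<partial>lborel)"

lemma laguerre_weight_nonneg: "laguerre_weight \<beta> x \<ge> 0"
  by (simp add: laguerre_weight_def)

lemma laguerre_weight_measurable [measurable]: "laguerre_weight \<beta> \<in> borel_measurable borel"
  unfolding laguerre_weight_def by measurable

lemma poly_measurable [measurable]: "poly (p :: real poly) \<in> borel_measurable borel"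
  by (intro borel_measurable_continuous_onI continuous_intros)

text \<open>No exception arises at the origin: both sides vanish there for every \<beta>, as
  \<open>0 powr 0 = 0\<close>.\<close>

lemma laguerre_weight_times_arg: "x * laguerre_weight \<beta> x = laguerre_weight (\<beta> + 1) x"
  by (auto simp: laguerre_weight_def powr_mult_base add.commute indicator_def)

lemma has_bochner_integral_laguerre_weight:
  assumes "\<beta> > -1"
  shows "has_bochner_integral lborel (laguerre_weight \<beta>) (Gamma (\<beta> + 1))"
proof (rule has_bochner_integral_nn_integral)
  have "(\<integral>\<^sup>+ x. ennreal (laguerre_weight \<beta> x) \<partial>lborel)
      = (\<integral>\<^sup>+ x. ennreal (indicator {0..} x * x powr (\<beta> + 1 - 1) / exp x) \<partial>lborel)"
    by (simp add: laguerre_weight_def exp_minus field_simps)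
  also have "\<dots> = ennreal (Gamma (\<beta> + 1))"
    using assms by (subst Gamma_conv_nn_integral_real) auto
  finally show "(\<integral>\<^sup>+ x. ennreal (laguerre_weight \<beta> x) \<partial>lborel) = ennreal (Gamma (\<beta> + 1))" .
qed (use assms in \<open>auto simp: laguerre_weight_nonneg Gamma_real_pos less_imp_le\<close>)

text \<open>Splitting off the constant coefficient leaves x times a polynomial, which is the same
  claim at \<beta> + 1; hence the induction generalizes \<beta>.\<close>

lemma integrable_laguerre_weight_poly:
  assumes "\<beta> > -1"
  shows "integrable lborel (\<lambda>x. laguerre_weight \<beta> x * poly p x)"
  using assms
proof (induction p arbitrary: \<beta>)
  case (pCons a p)
  have "integrable lborel (laguerre_weight \<beta>)"
    using has_bochner_integral_laguerre_weight[OF pCons.prems] by (simp add: has_bochner_integral_iff)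
  then have "integrable lborel (\<lambda>x. a * laguerre_weight \<beta> x + laguerre_weight (\<beta> + 1) x * poly p x)"
    using pCons by (intro Bochner_Integration.integrable_add) auto
  then show ?case
    unfolding laguerre_weight_times_arg[symmetric] by (simp add: algebra_simps)
qed simp

lemma laguerre_functional_add:
  assumes "\<beta> > -1"
  shows "laguerre_functional \<beta> (p + q) = laguerre_functional \<beta> p + laguerre_functional \<beta> q"
  using integrable_laguerre_weight_poly[OF assms]
  by (simp add: laguerre_functional_def algebra_simps)

lemma laguerre_functional_smult:
  "laguerre_functional \<beta> (smult c p) = c * laguerre_functional \<beta> p"
  unfolding laguerre_functional_def by (simp add: mult.left_commute)

lemma laguerre_functional_1:
  assumes "\<beta> > -1"
  shows "laguerre_functional \<beta> 1 = Gamma (\<beta> + 1)"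
  using has_bochner_integral_laguerre_weight[OF assms]
  by (simp add: laguerre_functional_def has_bochner_integral_iff)

lemma laguerre_functional_times_arg:
  "laguerre_functional \<beta> (pCons 0 p) = laguerre_functional (\<beta> + 1) p"
  unfolding laguerre_functional_def laguerre_weight_times_arg[symmetric]
  by (simp add: mult.assoc mult.left_commute)

lemma laguerre_functional_pCons:
  assumes "\<beta> > -1"
  shows "laguerre_functional \<beta> (pCons a p) = a * Gamma (\<beta> + 1) + laguerre_functional (\<beta> + 1) p"
proof -
  have "pCons a p = smult a 1 + pCons 0 p" by simp
  then show ?thesis
    using assms by (simp only: laguerre_functional_add laguerre_functional_smult
      laguerre_functional_1 laguerre_functional_times_arg)
qed

text \<open>A zero integral of this nonnegative function would force p to vanish almost everywhere
  on (0, 1), where the weight is positive, but p has finitely many roots.\<close>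

lemma laguerre_functional_pos:
  assumes "\<beta> > -1" "p \<noteq> 0"
  shows "laguerre_functional \<beta> (p\<^sup>2) > 0"
proof -
  have nn: "AE x in lborel. 0 \<le> laguerre_weight \<beta> x * poly (p\<^sup>2) x"
    by (simp add: laguerre_weight_nonneg poly_power)
  have "laguerre_functional \<beta> (p\<^sup>2) \<noteq> 0"
  proof
    assume "laguerre_functional \<beta> (p\<^sup>2) = 0"
    then have "AE x in lborel. laguerre_weight \<beta> x * poly (p\<^sup>2) x = 0"
      using integral_nonneg_eq_0_iff_AE[OF integrable_laguerre_weight_poly[OF assms(1)] nn]
      by (simp add: laguerre_functional_def)
    moreover have "AE x in lborel. x \<notin> {x. poly p x = 0}"
      using poly_roots_finite[OF assms(2)] by (intro AE_not_in) (auto simp: finite_imp_null_set_lborel)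
    ultimately have "AE x in lborel. x \<notin> {0<..<1::real}"
      by eventually_elim (auto simp: laguerre_weight_def poly_power)
    then have "{0<..<1::real} \<in> null_sets lborel" by (subst AE_iff_null_sets) auto
    then have "emeasure lborel {0<..<1::real} = 0" by blast
    then show False by simp
  qed
  moreover have "laguerre_functional \<beta> (p\<^sup>2) \<ge> 0"
    unfolding laguerre_functional_def using nn by (rule integral_nonneg_AE)
  ultimately show ?thesis by simp
qed

text \<open>Analytically, the integral of the derivative of x^(\<beta>+1) e^(-x) p(x) is 0. Boundary
  terms are avoided: induction on p with \<beta> varying reduces everything to the functional
  equation of Gamma.\<close>

lemma laguerre_integration_by_parts:
  assumes "\<beta> > -1"
  shows "laguerre_functional \<beta> (pCons 0 (pderiv p)) + (\<beta> + 1) * laguerre_functional \<beta> p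
    = laguerre_functional \<beta> (pCons 0 p)"
  using assms
proof (induction p arbitrary: \<beta>)
  case 0
  then show ?case by (simp add: laguerre_functional_def)
next
  case (pCons a p)
  have "Gamma (\<beta> + 1 + 1) = (\<beta> + 1) * Gamma (\<beta> + 1)"
    using pCons.prems by (intro Gamma_plus1) (auto elim!: nonpos_Ints_cases)
  with pCons.IH[of "\<beta> + 1"] pCons.prems show ?case
    by (simp add: pderiv_pCons laguerre_functional_pCons laguerre_functional_times_arg
      laguerre_functional_add algebra_simps)
qed

section \<open>Three-term recurrence, derivative and orthogonality of the polynomials\<close>

text \<open>In classical notation this is (-1)^n n! L_n^(\<alpha>). Taking the recurrence as
  definition lets every later property be derived algebraically.\<close>

fun monic_laguerre :: "real \<Rightarrow> nat \<Rightarrow> real poly" where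
  "monic_laguerre \<alpha> 0 = 1"
| "monic_laguerre \<alpha> (Suc 0) = [:- (\<alpha> + 1), 1:]"
| "monic_laguerre \<alpha> (Suc (Suc n)) = pCons 0 (monic_laguerre \<alpha> (Suc n))
    - smult (2 * real (Suc n) + \<alpha> + 1) (monic_laguerre \<alpha> (Suc n))
    - smult (real (Suc n) * (real (Suc n) + \<alpha>)) (monic_laguerre \<alpha> n)"

text \<open>At n = 0 the index n - 1 is truncated to 0, harmlessly, because its coefficient
  vanishes.\<close>

lemma monic_laguerre_Suc:
  "monic_laguerre \<alpha> (Suc n) = pCons 0 (monic_laguerre \<alpha> n)
    - smult (2 * real n + \<alpha> + 1) (monic_laguerre \<alpha> n)
    - smult (real n * (real n + \<alpha>)) (monic_laguerre \<alpha> (n - 1))"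
  by (cases n) auto

lemma degree_monic_laguerre: "degree (monic_laguerre \<alpha> n) = n"
  and lead_coeff_monic_laguerre: "lead_coeff (monic_laguerre \<alpha> n) = 1"
proof -
  \<comment> \<open>A degree bound and the top coefficient are carried through the recurrence
    together; they imply both claims.\<close>
  have "degree (monic_laguerre \<alpha> n) \<le> n \<and> coeff (monic_laguerre \<alpha> n) n = 1"
  proof (induction \<alpha> n rule: monic_laguerre.induct)
    case (3 \<alpha> n)
    let ?L = "monic_laguerre \<alpha>"
    have "degree (pCons 0 (?L (Suc n))) \<le> Suc (Suc n)"
      "degree (smult (2 * real (Suc n) + \<alpha> + 1) (?L (Suc n))) \<le> Suc (Suc n)"
      "degree (smult (real (Suc n) * (real (Suc n) + \<alpha>)) (?L n)) \<le> Suc (Suc n)"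
      using 3 by (auto intro: order.trans[OF degree_smult_le] order.trans[OF degree_pCons_le])
    then have "degree (?L (Suc (Suc n))) \<le> Suc (Suc n)"
      unfolding monic_laguerre.simps by (intro degree_diff_le)
    moreover have "coeff (?L (Suc n)) (Suc (Suc n)) = 0" "coeff (?L n) (Suc (Suc n)) = 0"
      using 3 by (auto intro!: coeff_eq_0)
    ultimately show ?case using 3 by (simp del: of_nat_Suc)
  qed auto
  then show "degree (monic_laguerre \<alpha> n) = n" "lead_coeff (monic_laguerre \<alpha> n) = 1"
    by (metis le_antisym le_degree zero_neq_one)+
qed

lemma monic_laguerre_nonzero: "monic_laguerre \<alpha> n \<noteq> 0"
  using lead_coeff_monic_laguerre[of \<alpha> n] by auto

text \<open>Differentiating the recurrence and multiplying by x expresses the new derivative through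
  the two preceding cases.\<close>

lemma pderiv_monic_laguerre:
  "pCons 0 (pderiv (monic_laguerre \<alpha> n)) = smult (real n) (monic_laguerre \<alpha> n)
    + smult (real n * (real n + \<alpha>)) (monic_laguerre \<alpha> (n - 1))"
proof -
  let ?P = "\<lambda>n. poly (monic_laguerre \<alpha> n)"
  have "x * poly (pderiv (monic_laguerre \<alpha> n)) x
      = real n * ?P n x + real n * (real n + \<alpha>) * ?P (n - 1) x" for x
  proof (induction \<alpha> n rule: monic_laguerre.induct)
    case (3 \<alpha> n)
    let ?P = "\<lambda>n. poly (monic_laguerre \<alpha> n) x" and ?D = "\<lambda>n. poly (pderiv (monic_laguerre \<alpha> n)) x"
    \<comment> \<open>The induction hypothesis at n brings in the polynomial of index n - 1;
      expanding index n + 1 as well leaves only indices n and n - 1 to compare.\<close>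
    have q: "?P (Suc n) = x * ?P n - (2 * real n + \<alpha> + 1) * ?P n - real n * (real n + \<alpha>) * ?P (n - 1)"
      by (simp add: monic_laguerre_Suc)
    have "x * ?D (Suc (Suc n)) = x * ?P (Suc n) + (x - (2 * (real n + 1) + \<alpha> + 1)) * (x * ?D (Suc n))
        - (real n + 1) * (real n + 1 + \<alpha>) * (x * ?D n)"
      unfolding monic_laguerre.simps pderiv_pCons pderiv_diff pderiv_smult
      by simp (simp add: algebra_simps)
    also have "\<dots> = (real n + 2) * ((x - (2 * (real n + 1) + \<alpha> + 1)) * ?P (Suc n)
          - (real n + 1) * (real n + 1 + \<alpha>) * ?P n) + (real n + 2) * (real n + 2 + \<alpha>) * ?P (Suc n)"
      unfolding 3 of_nat_Suc diff_Suc_1 q by (simp add: algebra_simps)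
    also have "(x - (2 * (real n + 1) + \<alpha> + 1)) * ?P (Suc n) - (real n + 1) * (real n + 1 + \<alpha>) * ?P n
        = ?P (Suc (Suc n))"
      by (simp add: algebra_simps)
    finally show ?case by (simp del: monic_laguerre.simps add: add_ac)
  qed (auto simp: pderiv_pCons)
  then show ?thesis
    by (intro poly_eq_poly_eq_iff[THEN iffD1] ext) simp
qed

declare monic_laguerre.simps(2,3) [simp del]

lemma laguerre_functional_recurrence:
  assumes "\<beta> > -1"
  shows "laguerre_functional \<beta> (pCons 0 (monic_laguerre \<alpha> n * q))
    = laguerre_functional \<beta> (monic_laguerre \<alpha> (Suc n) * q)
      + (2 * real n + \<alpha> + 1) * laguerre_functional \<beta> (monic_laguerre \<alpha> n * q)
      + real n * (real n + \<alpha>) * laguerre_functional \<beta> (monic_laguerre \<alpha> (n - 1) * q)"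
proof -
  have "pCons 0 (monic_laguerre \<alpha> n * q) = monic_laguerre \<alpha> (Suc n) * q
      + smult (2 * real n + \<alpha> + 1) (monic_laguerre \<alpha> n * q)
      + smult (real n * (real n + \<alpha>)) (monic_laguerre \<alpha> (n - 1) * q)"
    by (simp add: monic_laguerre_Suc algebra_simps)
  then show ?thesis
    using assms by (simp add: laguerre_functional_add laguerre_functional_smult)
qed

lemma laguerre_functional_pderiv_mult:
  assumes "\<beta> > -1"
  shows "laguerre_functional \<beta> (pCons 0 (pderiv (monic_laguerre \<alpha> m * monic_laguerre \<alpha> n)))
    = (real m + real n) * laguerre_functional \<beta> (monic_laguerre \<alpha> m * monic_laguerre \<alpha> n)
      + real m * (real m + \<alpha>) * laguerre_functional \<beta> (monic_laguerre \<alpha> (m - 1) * monic_laguerre \<alpha> n)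
      + real n * (real n + \<alpha>) * laguerre_functional \<beta> (monic_laguerre \<alpha> m * monic_laguerre \<alpha> (n - 1))"
proof -
  let ?L = "monic_laguerre \<alpha>"
  have "pCons 0 (pderiv (?L m * ?L n))
      = pCons 0 (pderiv (?L m)) * ?L n + ?L m * pCons 0 (pderiv (?L n))"
    by (simp add: pderiv_mult algebra_simps)
  also have "\<dots> = smult (real m + real n) (?L m * ?L n)
      + smult (real m * (real m + \<alpha>)) (?L (m - 1) * ?L n)
      + smult (real n * (real n + \<alpha>)) (?L m * ?L (n - 1))"
    by (simp add: pderiv_monic_laguerre algebra_simps smult_add_left)
  finally show ?thesis
    using assms by (simp add: laguerre_functional_add laguerre_functional_smult)
qed

text \<open>At exponent \<alpha>, integration by parts and the recurrence collapse to E(n+1) = -n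
  E(n), whose factor is 0 at n = 0.\<close>

lemma laguerre_functional_monic_laguerre:
  assumes "\<alpha> > -1"
  shows "laguerre_functional \<alpha> (monic_laguerre \<alpha> (Suc n)) = 0"
proof -
  let ?E = "\<lambda>n. laguerre_functional \<alpha> (monic_laguerre \<alpha> n)"
  have rec: "?E (Suc n) = - real n * ?E n" for n
    using laguerre_integration_by_parts[OF assms, of "monic_laguerre \<alpha> n"]
      laguerre_functional_pderiv_mult[OF assms, of \<alpha> n 0]
      laguerre_functional_recurrence[OF assms, of \<alpha> n 1]
    by (simp add: algebra_simps)
  show ?thesis by (induction n) (auto simp: rec)
qed

text \<open>The factor x may be attached to either polynomial of the product for indices k = m - 1
  and n. Expanding both ways by the recurrence, every term except the one for (m, n) is 0 by
  induction.\<close>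

lemma monic_laguerre_orthogonal_less:
  assumes "\<alpha> > -1" "m < n"
  shows "laguerre_functional \<alpha> (monic_laguerre \<alpha> m * monic_laguerre \<alpha> n) = 0"
  using assms(2)
proof (induction m arbitrary: n rule: less_induct)
  case (less m)
  let ?E = "\<lambda>m n. laguerre_functional \<alpha> (monic_laguerre \<alpha> m * monic_laguerre \<alpha> n)"
  show ?case
  proof (cases m)
    case 0
    with less.prems show ?thesis
      using laguerre_functional_monic_laguerre[OF assms(1), of "n - 1"] by simp
  next
    case (Suc k)
    have "?E k (Suc n) = 0" "?E k n = 0" "?E k (n - 1) = 0" "?E (k - 1) n = 0"
      using less Suc by auto
    then show ?thesis
      using laguerre_functional_recurrence[OF assms(1), of \<alpha> k "monic_laguerre \<alpha> n"]
        laguerre_functional_recurrence[OF assms(1), of \<alpha> n "monic_laguerre \<alpha> k"]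
      by (simp add: Suc mult.commute)
  qed
qed

lemma monic_laguerre_orthogonal:
  assumes "\<alpha> > -1" "m \<noteq> n"
  shows "laguerre_functional \<alpha> (monic_laguerre \<alpha> m * monic_laguerre \<alpha> n) = 0"
  using assms monic_laguerre_orthogonal_less[of \<alpha> m n] monic_laguerre_orthogonal_less[of \<alpha> n m]
  by (cases "m < n") (auto simp: mult.commute)

section \<open>Squared norms, fractional moments and their recurrence\<close>

definition laguerre_sq_norm :: "real \<Rightarrow> nat \<Rightarrow> real" where
  "laguerre_sq_norm \<alpha> n = laguerre_functional \<alpha> ((monic_laguerre \<alpha> n)\<^sup>2)"

lemma laguerre_sq_norm_pos: "\<alpha> > -1 \<Longrightarrow> laguerre_sq_norm \<alpha> n > 0"
  unfolding laguerre_sq_norm_def by (rule laguerre_functional_pos[OF _ monic_laguerre_nonzero])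

text \<open>The integral of x times the product of neighbouring polynomials is expanded by the
  recurrence in each factor; orthogonality leaves one norm on each side.\<close>

lemma laguerre_sq_norm_Suc:
  assumes "\<alpha> > -1"
  shows "laguerre_sq_norm \<alpha> (Suc n) = real (Suc n) * (real (Suc n) + \<alpha>) * laguerre_sq_norm \<alpha> n"
  using laguerre_functional_recurrence[OF assms, of \<alpha> n "monic_laguerre \<alpha> (Suc n)"]
    laguerre_functional_recurrence[OF assms, of \<alpha> "Suc n" "monic_laguerre \<alpha> n"]
    monic_laguerre_orthogonal[OF assms, of "n - 1" "Suc n"]
    monic_laguerre_orthogonal[OF assms, of n "Suc n"]
    monic_laguerre_orthogonal[OF assms, of "Suc (Suc n)" n]
  by (simp add: laguerre_sq_norm_def power2_eq_square mult.commute)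

text \<open>The factor x^s of the moment is absorbed into the exponent of the weight.\<close>

definition laguerre_moment :: "real \<Rightarrow> real \<Rightarrow> nat \<Rightarrow> real" where
  "laguerre_moment \<alpha> s k
    = laguerre_functional (\<alpha> + s) ((monic_laguerre \<alpha> k)\<^sup>2) / laguerre_sq_norm \<alpha> k"

lemma laguerre_moment_pos:
  assumes "\<alpha> > -1" "\<alpha> + s > -1"
  shows "laguerre_moment \<alpha> s k > 0"
  unfolding laguerre_moment_def
  using laguerre_functional_pos[OF assms(2) monic_laguerre_nonzero] laguerre_sq_norm_pos[OF assms(1)]
  by simp

text \<open>
  Integration by parts applied to \<open>p\<^sub>n\<^sup>2\<close> and to \<open>p\<^sub>n p\<^sub>n\<^sub>+\<^sub>1\<close> against \<open>x\<^bsup>\<alpha>+s\<^esup> e\<^bsup>-x\<^esup>\<close> gives the two relations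
  \<open>diag\<close> and \<open>off_diag\<close>; the first sums up to \<open>M\<close>, the second gives its second difference.
\<close>

lemma laguerre_moment_sum_recurrence:
  assumes \<alpha>: "\<alpha> > -1" and s: "\<alpha> + s > -1" and "n \<ge> 1"
  defines "M \<equiv> \<lambda>n. \<Sum>k<n. laguerre_moment \<alpha> s k"
  shows "real n * (real n + \<alpha>) * (M (n + 1) - 2 * M n + M (n - 1)) = s * (s + 1) * M n"
proof -
  let ?Y = "\<lambda>m n. laguerre_functional (\<alpha> + s) (monic_laguerre \<alpha> m * monic_laguerre \<alpha> n)"
  let ?h = "laguerre_sq_norm \<alpha>" and ?a = "laguerre_moment \<alpha> s"
  have h: "?h n > 0" for n using laguerre_sq_norm_pos[OF \<alpha>] .
  have Y: "?Y n n = ?a n * ?h n" for n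
    using h[of n] by (simp add: laguerre_moment_def power2_eq_square)
  have diag: "?Y (Suc n) n = real n * (real n + \<alpha>) * ?Y n (n - 1) + s * ?Y n n" for n
    using laguerre_integration_by_parts[OF s, of "monic_laguerre \<alpha> n * monic_laguerre \<alpha> n"]
      laguerre_functional_pderiv_mult[OF s, of \<alpha> n n]
      laguerre_functional_recurrence[OF s, of \<alpha> n "monic_laguerre \<alpha> n"]
    by (simp add: mult.commute algebra_simps)
  have off_diag: "?Y (Suc n) (Suc n)
      = real (Suc n) * (real (Suc n) + \<alpha>) * ?Y n n + (s + 1) * ?Y (Suc n) n" for n
    using laguerre_integration_by_parts[OF s, of "monic_laguerre \<alpha> n * monic_laguerre \<alpha> (Suc n)"]
      laguerre_functional_pderiv_mult[OF s, of \<alpha> n "Suc n"]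
      laguerre_functional_recurrence[OF s, of \<alpha> n "monic_laguerre \<alpha> (Suc n)"]
    by (simp add: mult.commute algebra_simps)
  \<comment> \<open>Divided by the norm of index n, \<open>diag\<close> reads z(n) = z(n-1) + s
    a(n), because n (n + \<alpha>) is the ratio of consecutive norms; the sum telescopes.\<close>
  have z: "?Y (Suc n) n = s * M (Suc n) * ?h n" for n
  proof (induction n)
    case 0
    show ?case using diag[of 0] Y[of 0] by (simp add: M_def)
  next
    case (Suc n)
    show ?case
      using diag[of "Suc n"] Suc laguerre_sq_norm_Suc[OF \<alpha>, of n]
      by (simp add: M_def Y algebra_simps)
  qed
  obtain k where n: "n = Suc k" using \<open>n \<ge> 1\<close> by (cases n) auto
  let ?b = "real n * (real n + \<alpha>)"
  \<comment> \<open>This is \<open>off_diag\<close> with \<open>z\<close> inserted and all norms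
    expressed through the one of index k = n - 1.\<close>
  have "?a n * (?b * ?h k) = ?b * (?a k * ?h k) + (s + 1) * (s * M n * ?h k)"
    using off_diag[of k] laguerre_sq_norm_Suc[OF \<alpha>, of k] by (simp only: Y z n)
  then have "(?b * (?a n - ?a k)) * ?h k = (s * (s + 1) * M n) * ?h k"
    by (simp add: algebra_simps)
  then have "?b * (?a n - ?a k) = s * (s + 1) * M n"
    using h[of k] by simp
  moreover have "M (n + 1) - 2 * M n + M (n - 1) = ?a n - ?a k"
    by (simp add: M_def n)
  ultimately show ?thesis by simp
qed

section \<open>The Vandermonde determinant\<close>

text \<open>As a function of the last node, the determinant is a polynomial of degree at most n that
  vanishes at the earlier nodes and has the smaller determinant as coefficient of degree n.\<close>

lemma vandermonde_monic:
  fixes p :: "nat \<Rightarrow> 'a :: field poly" and x :: "nat \<Rightarrow> 'a"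
  assumes monic: "\<And>i. degree (p i) = i" "\<And>i. lead_coeff (p i) = 1"
  shows "det (mat n n (\<lambda>(i, j). poly (p i) (x j))) = (\<Prod>j<n. \<Prod>i<j. x j - x i)"
proof (induction n)
  case 0
  show ?case by (simp add: det_dim_zero)
next
  case (Suc n)
  define A where "A t = mat (Suc n) (Suc n) (\<lambda>(i, j). poly (p i) (if j = n then t else x j))" for t
  \<comment> \<open>The cofactors of the last column do not see t, so they may be computed at t =
    0.\<close>
  define c where "c i = cofactor (A 0) i n" for i
  define f where "f = (\<Sum>i<Suc n. smult (c i) (p i))"
  have carrier: "A t \<in> carrier_mat (Suc n) (Suc n)" for t by (simp add: A_def)
  have delete: "mat_delete (A t) i n = mat_delete (A 0) i n" for t i
    by (rule eq_matI) (auto simp: mat_delete_def A_def)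
  have entry: "A t $$ (i, n) = poly (p i) t" if "i < Suc n" for t i
    using that by (simp add: A_def)
  have det: "det (A t) = poly f t" for t
  proof -
    have "det (A t) = (\<Sum>i<Suc n. A t $$ (i, n) * cofactor (A t) i n)"
      by (rule laplace_expansion_column[OF carrier]) simp
    also have "\<dots> = (\<Sum>i<Suc n. c i * poly (p i) t)"
      by (intro sum.cong refl) (simp add: entry c_def cofactor_def delete[of t])
    finally show ?thesis by (simp only: f_def poly_sum poly_smult)
  qed
  have "mat_delete (A 0) n n = mat n n (\<lambda>(i, j). poly (p i) (x j))"
    by (rule eq_matI) (auto simp: mat_delete_def A_def)
  then have cn: "c n = (\<Prod>j<n. \<Prod>i<j. x j - x i)"
    using Suc.IH by (simp add: c_def cofactor_def)
  have root: "poly f (x i) = 0" if "i < n" for i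
    unfolding det[symmetric]
    by (rule det_identical_columns[OF carrier, of i n]) (use that in \<open>auto simp: A_def intro!: eq_vecI\<close>)
  have main: "poly f (x n) = c n * (\<Prod>i<n. x n - x i)"
  proof (cases "inj_on x {..<n}")
    case True
    \<comment> \<open>The top coefficients cancel, so g has degree below n or is 0, yet it vanishes
      at n distinct nodes.\<close>
    define g where "g = f - smult (c n) (\<Prod>i<n. [:- x i, 1:])"
    have P: "degree (\<Prod>i<n. [:- x i, 1:]) = n" "lead_coeff (\<Prod>i<n. [:- x i, 1:]) = 1"
      by (simp add: degree_prod_eq_sum_degree) (simp only: lead_coeff_prod, simp)
    have "degree g \<le> n"
      unfolding g_def f_def using monic P
      by (intro degree_diff_le degree_sum_le order.trans[OF degree_smult_le]) auto
    moreover have "coeff g n = 0"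
    proof -
      have "coeff (p i) n = (if i = n then 1 else 0)" if "i < Suc n" for i
        using monic[of i] that by (auto intro: coeff_eq_0)
      then have "coeff f n = c n"
        by (simp add: f_def coeff_sum if_distrib[of "\<lambda>y. _ * y"] cong: if_cong)
      then show ?thesis using P by (simp add: g_def)
    qed
    ultimately have deg: "g = 0 \<or> degree g < n"
      by (metis leading_coeff_0_iff le_neq_implies_less)
    have "g = 0"
    proof (rule ccontr)
      assume "g \<noteq> 0"
      have "x ` {..<n} \<subseteq> {t. poly g t = 0}"
        using root by (auto simp: g_def poly_prod)
      then have "card (x ` {..<n}) \<le> card {t. poly g t = 0}"
        using poly_roots_finite[OF \<open>g \<noteq> 0\<close>] by (intro card_mono)
      with card_poly_roots_bound[OF \<open>g \<noteq> 0\<close>] deg \<open>g \<noteq> 0\<close> card_image[OF True] show False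
        by simp
    qed
    then have "poly f (x n) = poly (smult (c n) (\<Prod>i<n. [:- x i, 1:])) (x n)"
      by (simp add: g_def)
    then show ?thesis by (simp add: poly_prod)
  next
    case False
    \<comment> \<open>With a repeated node both sides are 0: the left by equal columns, the right
      because c(n) contains the factor x(j) - x(i).\<close>
    then obtain i j where ij: "i < j" "j < n" "x i = x j"
      by (auto simp: inj_on_def) (metis linorder_neqE_nat)
    then have "\<exists>i\<in>{..<j}. x j - x i = 0" by (intro bexI[of _ i]) auto
    then have "(\<Prod>i<j. x j - x i) = 0" by (intro prod_zero) auto
    with ij have "\<exists>j\<in>{..<n}. (\<Prod>i<j. x j - x i) = 0" by blast
    then have "c n = 0" unfolding cn by (intro prod_zero) auto
    moreover have "det (A (x n)) = 0"
      by (rule det_identical_columns[OF carrier, of i j]) (use ij in \<open>auto simp: A_def intro!: eq_vecI\<close>)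
    ultimately show ?thesis by (simp add: det)
  qed
  have "mat (Suc n) (Suc n) (\<lambda>(i, j). poly (p i) (x j)) = A (x n)"
    by (rule eq_matI) (auto simp: A_def)
  then show ?case using main cn by (simp add: det)
qed

section \<open>From ordered to unordered eigenvalues\<close>

lemma measurable_PiM_permute:
  assumes "\<pi> permutes I"
  shows "(\<lambda>x. x \<circ> \<pi>) \<in> measurable (Pi\<^sub>M I (\<lambda>_. M)) (Pi\<^sub>M I (\<lambda>_. M))"
  using permutes_in_image[OF assms]
  by (intro measurable_PiM_single')
    (auto simp: space_PiM PiE_iff extensional_def intro!: measurable_component_singleton)

text \<open>It suffices to compare boxes: the preimage of a box is the box with its sides permuted
  by the inverse, and the product of side measures is unchanged.\<close>

lemma distr_PiM_permute:
  assumes "sigma_finite_measure M" "finite I" "\<pi> permutes I"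
  shows "distr (Pi\<^sub>M I (\<lambda>_. M)) (Pi\<^sub>M I (\<lambda>_. M)) (\<lambda>x. x \<circ> \<pi>) = Pi\<^sub>M I (\<lambda>_. M)"
proof -
  interpret product_sigma_finite "\<lambda>_. M" using assms(1) by (simp add: product_sigma_finite_def)
  have \<pi>: "\<pi> i \<in> I \<longleftrightarrow> i \<in> I" for i using permutes_in_image[OF assms(3)] .
  show ?thesis
  proof (rule PiM_eqI)
    fix A assume A: "\<And>i. i \<in> I \<Longrightarrow> A i \<in> sets M"
    have inv: "Hilbert_Choice.inv \<pi> permutes I" by (rule permutes_inv[OF assms(3)])
    have inv_in: "Hilbert_Choice.inv \<pi> i \<in> I \<longleftrightarrow> i \<in> I" for i using permutes_in_image[OF inv] .
    have B: "A (Hilbert_Choice.inv \<pi> i) \<in> sets M" if "i \<in> I" for i using A that inv_in by simp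
    have "(\<lambda>x. x \<circ> \<pi>) -` Pi\<^sub>E I A \<inter> space (Pi\<^sub>M I (\<lambda>_. M)) = Pi\<^sub>E I (\<lambda>i. A (Hilbert_Choice.inv \<pi> i))"
    proof (intro equalityI subsetI)
      fix x assume x: "x \<in> (\<lambda>x. x \<circ> \<pi>) -` Pi\<^sub>E I A \<inter> space (Pi\<^sub>M I (\<lambda>_. M))"
      have "x i \<in> A (Hilbert_Choice.inv \<pi> i)" if "i \<in> I" for i
        using x inv_in[of i] that permutes_inverses(1)[OF assms(3), of i] by (auto simp: PiE_iff)
      with x show "x \<in> Pi\<^sub>E I (\<lambda>i. A (Hilbert_Choice.inv \<pi> i))" by (auto simp: space_PiM PiE_iff)
    next
      fix x assume x: "x \<in> Pi\<^sub>E I (\<lambda>i. A (Hilbert_Choice.inv \<pi> i))"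
      have "x (\<pi> i) \<in> A i" if "i \<in> I" for i
        using x that \<pi>[of i] permutes_inverses(2)[OF assms(3), of i] by (auto simp: PiE_iff)
      moreover have "x \<in> space (Pi\<^sub>M I (\<lambda>_. M))"
        using x B[THEN sets.sets_into_space] by (auto simp: space_PiM PiE_iff)
      ultimately show "x \<in> (\<lambda>x. x \<circ> \<pi>) -` Pi\<^sub>E I A \<inter> space (Pi\<^sub>M I (\<lambda>_. M))"
        using x by (auto simp: PiE_iff extensional_def \<pi>)
    qed
    then have "emeasure (distr (Pi\<^sub>M I (\<lambda>_. M)) (Pi\<^sub>M I (\<lambda>_. M)) (\<lambda>x. x \<circ> \<pi>)) (Pi\<^sub>E I A)
        = emeasure (Pi\<^sub>M I (\<lambda>_. M)) (Pi\<^sub>E I (\<lambda>i. A (Hilbert_Choice.inv \<pi> i)))"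
      using A assms(2) by (subst emeasure_distr[OF measurable_PiM_permute[OF assms(3)]]) (auto intro!: sets_PiM_I_finite)
    also have "\<dots> = (\<Prod>i\<in>I. emeasure M (A (Hilbert_Choice.inv \<pi> i)))"
      using B assms(2) by (intro emeasure_PiM) auto
    also have "\<dots> = (\<Prod>i\<in>I. emeasure M (A i))"
      using prod.permute[OF inv, of "\<lambda>i. emeasure M (A i)"] by (simp add: o_def)
    finally show "emeasure (distr (Pi\<^sub>M I (\<lambda>_. M)) (Pi\<^sub>M I (\<lambda>_. M)) (\<lambda>x. x \<circ> \<pi>)) (Pi\<^sub>E I A)
        = (\<Prod>i\<in>I. emeasure M (A i))" .
  qed (use assms in auto)
qed

lemma has_bochner_integral_PiM_permute:
  fixes f :: "('a \<Rightarrow> 'b) \<Rightarrow> real"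
  assumes "sigma_finite_measure M" "finite I" "\<pi> permutes I" "integrable (Pi\<^sub>M I (\<lambda>_. M)) f"
  shows "has_bochner_integral (Pi\<^sub>M I (\<lambda>_. M)) (\<lambda>x. f (x \<circ> \<pi>)) (\<integral>x. f x \<partial>Pi\<^sub>M I (\<lambda>_. M))"
proof -
  let ?P = "Pi\<^sub>M I (\<lambda>_. M)"
  have "integrable (distr ?P ?P (\<lambda>x. x \<circ> \<pi>)) f"
    by (simp add: distr_PiM_permute assms)
  then have "integrable ?P (\<lambda>x. f (x \<circ> \<pi>))"
    using assms by (simp add: integrable_distr_eq measurable_PiM_permute)
  moreover have "(\<integral>x. f (x \<circ> \<pi>) \<partial>?P) = (\<integral>x. f x \<partial>distr ?P ?P (\<lambda>x. x \<circ> \<pi>))"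
    using assms by (intro integral_distr[symmetric] measurable_PiM_permute) auto
  ultimately show ?thesis
    by (simp add: has_bochner_integral_iff distr_PiM_permute assms)
qed

text \<open>The sorting permutation is the inverse of the rank function \<open>i \<mapsto> |{j. x\<^sub>i \<le> x\<^sub>j}|\<close>.\<close>

lemma ex1_permutation_antimono:
  fixes x :: "nat \<Rightarrow> 'a :: linorder"
  assumes inj: "inj_on x {1..n}"
  shows "\<exists>!\<pi>. \<pi> permutes {1..n} \<and> (\<forall>i\<in>{1..n}. \<forall>j\<in>{1..n}. i \<le> j \<longrightarrow> x (\<pi> j) \<le> x (\<pi> i))"
proof -
  define up where "up i = {j \<in> {1..n}. x i \<le> x j}" for i
  define r where "r i = (if i \<in> {1..n} then card (up i) else i)" for i
  have fin: "finite (up i)" for i by (simp add: up_def)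
  have less: "r i < r j" if "i \<in> {1..n}" "j \<in> {1..n}" "x j < x i" for i j
  proof -
    have "up i \<subseteq> up j" "j \<in> up j" "j \<notin> up i" using that by (auto simp: up_def)
    then have "up i \<subset> up j" by blast
    then show ?thesis using that fin by (simp add: r_def psubset_card_mono)
  qed
  have "inj_on r {1..n}"
  proof (rule inj_onI)
    fix i j assume "i \<in> {1..n}" "j \<in> {1..n}" "r i = r j"
    then have "x i = x j" using less[of i j] less[of j i] by (cases "x i" "x j" rule: linorder_cases) auto
    with inj \<open>i \<in> {1..n}\<close> \<open>j \<in> {1..n}\<close> show "i = j" by (auto dest: inj_onD)
  qed
  moreover have "r ` {1..n} \<subseteq> {1..n}"
  proof (intro image_subsetI)
    fix i assume i: "i \<in> {1..n}"
    then have "i \<in> up i" by (simp add: up_def)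
    then have "card (up i) \<ge> 1" using fin[of i] by (metis One_nat_def Suc_leI card_gt_0_iff empty_iff)
    moreover have "card (up i) \<le> card {1..n}" by (intro card_mono) (auto simp: up_def)
    ultimately show "r i \<in> {1..n}" using i by (simp add: r_def)
  qed
  ultimately have "bij_betw r {1..n} {1..n}"
    by (simp add: bij_betw_def endo_inj_surj)
  then have r: "r permutes {1..n}" by (rule bij_imp_permutes) (auto simp: r_def)
  show ?thesis
  proof (intro ex1I[of _ "Hilbert_Choice.inv r"] conjI ballI impI)
    show "Hilbert_Choice.inv r permutes {1..n}" using r by (rule permutes_inv)
    fix i j assume ij: "i \<in> {1..n}" "j \<in> {1..n}" "i \<le> j"
    then have "Hilbert_Choice.inv r i \<in> {1..n}" "Hilbert_Choice.inv r j \<in> {1..n}" using permutes_in_image[OF permutes_inv[OF r]] by auto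
    with less[of "Hilbert_Choice.inv r j" "Hilbert_Choice.inv r i"] ij show "x (Hilbert_Choice.inv r j) \<le> x (Hilbert_Choice.inv r i)"
      by (metis linorder_not_less permutes_inverses(1) r)
  next
    fix \<sigma> assume \<sigma>: "\<sigma> permutes {1..n} \<and> (\<forall>i\<in>{1..n}. \<forall>j\<in>{1..n}. i \<le> j \<longrightarrow> x (\<sigma> j) \<le> x (\<sigma> i))"
    then have perm: "\<sigma> permutes {1..n}" by blast
    \<comment> \<open>Uniqueness: if \<sigma> sorts x, the indices with value at least
      x(\<sigma>(i)) are exactly \<sigma>(1), ..., \<sigma>(i), so the rank function undoes
      \<sigma>.\<close>
    have "r (\<sigma> i) = i" for i
    proof (cases "i \<in> {1..n}")
      case True
      have "up (\<sigma> i) = \<sigma> ` {1..i}"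
      proof (intro equalityI subsetI)
        fix j assume j: "j \<in> up (\<sigma> i)"
        then have "j \<in> \<sigma> ` {1..n}" using permutes_image[OF perm] by (simp add: up_def)
        then obtain k where k: "k \<in> {1..n}" "j = \<sigma> k" by auto
        have "k \<le> i"
        proof (rule ccontr)
          assume "\<not> k \<le> i"
          then have "x (\<sigma> k) \<le> x (\<sigma> i)" using \<sigma> k True by auto
          then have "x (\<sigma> k) = x (\<sigma> i)" using j k by (auto simp: up_def)
          then have "\<sigma> k = \<sigma> i"
            using inj k True permutes_in_image[OF perm] by (auto dest: inj_onD)
          then show False using \<open>\<not> k \<le> i\<close> permutes_inj[OF perm] by (auto dest: injD)
        qed
        with k show "j \<in> \<sigma> ` {1..i}" by auto
      next
        fix j assume "j \<in> \<sigma> ` {1..i}"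
        then obtain k where k: "k \<in> {1..i}" "j = \<sigma> k" by auto
        then have "k \<in> {1..n}" using True by auto
        with k \<sigma> True permutes_in_image[OF perm, of k] show "j \<in> up (\<sigma> i)" by (auto simp: up_def)
      qed
      then have "card (up (\<sigma> i)) = i"
        using permutes_inj_on[OF perm] by (simp add: card_image)
      then show ?thesis using True permutes_in_image[OF perm] by (simp add: r_def)
    next
      case False
      then show ?thesis using permutes_not_in[OF perm False] permutes_not_in[OF r False] by simp
    qed
    then show "\<sigma> = Hilbert_Choice.inv r" by (metis ext permutes_inverses(2) r)
  qed
qed

section \<open>Symmetry of the discriminant and symmetrization of the density\<close>

definition discriminant :: "nat \<Rightarrow> (nat \<Rightarrow> real) \<Rightarrow> real" where
  "discriminant n x = (\<Prod>i=1..n. \<Prod>j=i+1..n. (x i - x j)\<^sup>2)"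

text \<open>Over ordered pairs each square splits into two equal absolute values, and the product
  becomes visibly symmetric.\<close>

lemma discriminant_eq_prod_abs:
  "discriminant n x = (\<Prod>i\<in>{1..n}. \<Prod>j\<in>{1..n} - {i}. \<bar>x i - x j\<bar>)"
proof -
  let ?g = "\<lambda>i j. \<bar>x i - x j\<bar>"
  have "(\<Prod>i\<in>{1..n}. \<Prod>j\<in>{1..n} - {i}. ?g i j)
      = (\<Prod>i\<in>{1..n}. (\<Prod>j\<in>{i+1..n}. ?g i j) * (\<Prod>j\<in>{1..<i}. ?g i j))"
  proof (rule prod.cong[OF refl])
    fix i assume "i \<in> {1..n}"
    then have split: "{1..n} - {i} = {i+1..n} \<union> {1..<i}" by auto
    have "{i+1..n} \<inter> {1..<i} = {}" by auto
    then show "(\<Prod>j\<in>{1..n} - {i}. ?g i j) = (\<Prod>j\<in>{i+1..n}. ?g i j) * (\<Prod>j\<in>{1..<i}. ?g i j)"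
      unfolding split by (intro prod.union_disjoint finite_atLeastAtMost finite_atLeastLessThan)
  qed
  also have "\<dots> = (\<Prod>i\<in>{1..n}. \<Prod>j\<in>{i+1..n}. ?g i j) * (\<Prod>i\<in>{1..n}. \<Prod>j\<in>{1..<i}. ?g i j)"
    by (rule prod.distrib)
  also have "(\<Prod>i\<in>{1..n}. \<Prod>j\<in>{1..<i}. ?g i j) = (\<Prod>i\<in>{1..n}. \<Prod>j\<in>{i+1..n}. ?g i j)"
  proof -
    have "(\<Prod>i\<in>{1..n}. \<Prod>j\<in>{1..<i}. ?g i j) = (\<Prod>(i, j)\<in>Sigma {1..n} (\<lambda>i. {1..<i}). ?g i j)"
      by (rule prod.Sigma) auto
    also have "\<dots> = (\<Prod>(i, j)\<in>Sigma {1..n} (\<lambda>i. {i+1..n}). ?g i j)"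
      by (rule prod.reindex_bij_witness[of _ prod.swap prod.swap]) auto
    also have "\<dots> = (\<Prod>i\<in>{1..n}. \<Prod>j\<in>{i+1..n}. ?g i j)"
      by (rule prod.Sigma[symmetric]) auto
    finally show ?thesis .
  qed
  finally show ?thesis
    by (simp only: discriminant_def prod.distrib[symmetric] power2_eq_square abs_mult_self_eq)
qed

lemma discriminant_permute:
  assumes \<pi>: "\<pi> permutes {1..n}"
  shows "discriminant n (x \<circ> \<pi>) = discriminant n x"
proof -
  have "(\<Prod>j\<in>{1..n} - {i}. \<bar>x (\<pi> i) - x (\<pi> j)\<bar>) = (\<Prod>j\<in>{1..n} - {\<pi> i}. \<bar>x (\<pi> i) - x j\<bar>)" for i
  proof -
    have "\<pi> ` ({1..n} - {i}) = {1..n} - {\<pi> i}"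
      by (simp only: image_set_diff[OF permutes_inj[OF \<pi>]] permutes_image[OF \<pi>] image_insert image_empty)
    then show ?thesis
      using prod.reindex[OF permutes_inj_on[OF \<pi>, of "{1..n} - {i}"], of "\<lambda>j. \<bar>x (\<pi> i) - x j\<bar>"]
      by (simp only: o_def)
  qed
  then have "discriminant n (x \<circ> \<pi>) = (\<Prod>i\<in>{1..n}. \<Prod>j\<in>{1..n} - {\<pi> i}. \<bar>x (\<pi> i) - x j\<bar>)"
    by (simp add: discriminant_eq_prod_abs)
  also have "\<dots> = discriminant n x"
    using prod.permute[OF \<pi>, of "\<lambda>i. \<Prod>j\<in>{1..n} - {i}. \<bar>x i - x j\<bar>"]
    by (simp add: discriminant_eq_prod_abs o_def)
  finally show ?thesis .
qed

lemma inj_on_if_discriminant_nonzero: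
  assumes "discriminant n x \<noteq> 0"
  shows "inj_on x {1..n}"
  using assms unfolding discriminant_eq_prod_abs
  by (auto simp: inj_on_def)

lemma discriminant_nonneg: "discriminant n x \<ge> 0"
  by (auto simp: discriminant_def intro!: prod_nonneg)

definition unordered_weight :: "real \<Rightarrow> nat \<Rightarrow> (nat \<Rightarrow> real) \<Rightarrow> real" where
  "unordered_weight \<alpha> n x = (\<Prod>i=1..n. laguerre_weight \<alpha> (x i)) * discriminant n x"

lemma unordered_weight_nonneg: "unordered_weight \<alpha> n x \<ge> 0"
  by (simp add: unordered_weight_def discriminant_nonneg laguerre_weight_nonneg prod_nonneg)

lemma unordered_weight_permute:
  assumes "\<pi> permutes {1..n}"
  shows "unordered_weight \<alpha> n (x \<circ> \<pi>) = unordered_weight \<alpha> n x"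
  using prod.permute[OF assms, of "\<lambda>i. laguerre_weight \<alpha> (x i)"]
  unfolding unordered_weight_def discriminant_permute[OF assms] by (simp add: o_def)

lemma lue_weight_eq: "lue_weight \<alpha> n x = indicator (ordered_region n) x * unordered_weight \<alpha> n x"
proof (cases "x \<in> ordered_region n")
  case True
  then have "(\<Prod>i=1..n. laguerre_weight \<alpha> (x i)) = (\<Prod>i=1..n. x i powr \<alpha> * exp (- x i))"
    by (intro prod.cong) (auto simp: laguerre_weight_def ordered_region_def)
  also have "\<dots> = exp (- (\<Sum>i=1..n. x i)) * (\<Prod>i=1..n. x i powr \<alpha>)"
    by (simp add: prod.distrib exp_sum[symmetric] sum_negf mult.commute)
  finally show ?thesis
    by (simp add: lue_weight_def unordered_weight_def discriminant_def)
qed (simp add: lue_weight_def)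

text \<open>Ties need no null-set argument, since both sides vanish with the discriminant.\<close>

lemma sum_lue_weight_permute:
  "(\<Sum>\<pi> | \<pi> permutes {1..n}. lue_weight \<alpha> n (x \<circ> \<pi>)) = unordered_weight \<alpha> n x"
proof (cases "unordered_weight \<alpha> n x = 0")
  case False
  then have "\<forall>i\<in>{1..n}. laguerre_weight \<alpha> (x i) \<noteq> 0" "discriminant n x \<noteq> 0"
    by (auto simp: unordered_weight_def)
  then have nonneg: "\<forall>i\<in>{1..n}. 0 \<le> x i" and inj: "inj_on x {1..n}"
    using inj_on_if_discriminant_nonzero by (auto simp: laguerre_weight_def indicator_def)
  let ?S = "{\<pi>. \<pi> permutes {1..n}}" and ?T = "{\<pi>. \<pi> permutes {1..n} \<and> x \<circ> \<pi> \<in> ordered_region n}"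
  \<comment> \<open>Nonnegativity survives permutation, so membership only asks that \<pi> sorts x;
    exactly one \<pi> does.\<close>
  have "x \<circ> \<pi> \<in> ordered_region n
      \<longleftrightarrow> (\<forall>i\<in>{1..n}. \<forall>j\<in>{1..n}. i \<le> j \<longrightarrow> x (\<pi> j) \<le> x (\<pi> i))" if "\<pi> permutes {1..n}" for \<pi>
    using nonneg permutes_in_image[OF that] unfolding ordered_region_def o_def mem_Collect_eq by blast
  then have "\<exists>!\<pi>. \<pi> \<in> ?T"
    using ex1_permutation_antimono[OF inj] unfolding mem_Collect_eq by metis
  then obtain \<pi>\<^sub>0 where T: "?T = {\<pi>\<^sub>0}"
    unfolding singleton_conv[symmetric] by blast
  have "(\<Sum>\<pi>\<in>?S. lue_weight \<alpha> n (x \<circ> \<pi>))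
      = (\<Sum>\<pi>\<in>?S. if x \<circ> \<pi> \<in> ordered_region n then unordered_weight \<alpha> n x else 0)"
    by (intro sum.cong) (auto simp: lue_weight_eq unordered_weight_permute)
  also have "\<dots> = (\<Sum>\<pi>\<in>?T. unordered_weight \<alpha> n x)"
    by (subst sum.inter_filter[symmetric]) (auto simp: finite_permutations)
  finally show ?thesis unfolding T by simp
qed (simp add: lue_weight_eq unordered_weight_permute)

lemma ordered_region_measurable [measurable]:
  "(\<lambda>x. indicator (ordered_region n) x :: real) \<in> borel_measurable (lebesgue_n n)"
proof -
  have coord: "(\<lambda>x. x i) \<in> borel_measurable (lebesgue_n n)" if "i \<in> {1..n}" for i
    using measurable_component_singleton[OF that, of "\<lambda>_. lborel"] by simp
  have le: "Measurable.pred (lebesgue_n n) (\<lambda>x. x j \<le> x i)" if "i \<in> {1..n}" "j \<in> {1..n}" for i j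
    unfolding pred_def using borel_measurable_le[OF coord[OF that(2)] coord[OF that(1)]] .
  have ge: "Measurable.pred (lebesgue_n n) (\<lambda>x. 0 \<le> x i)" if "i \<in> {1..n}" for i
    unfolding pred_def using borel_measurable_le[OF borel_measurable_const coord[OF that]] .
  have "Measurable.pred (lebesgue_n n) (\<lambda>x. x \<in> ordered_region n)"
    unfolding ordered_region_def mem_Collect_eq
    by (intro pred_intros_logic pred_intros_finite le ge) auto
  then show ?thesis by measurable
qed

lemma unordered_weight_measurable [measurable]:
  "unordered_weight \<alpha> n \<in> borel_measurable (lebesgue_n n)"
  unfolding unordered_weight_def discriminant_def by measurable

text \<open>The symmetric integrand is the sum of the n! permuted ordered ones, and each of them has
  the same integral by invariance of the product measure.\<close>

lemma integral_lue_weight_symmetric: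
  assumes G: "G \<in> borel_measurable (lebesgue_n n)"
    and sym: "\<And>x \<pi>. \<pi> permutes {1..n} \<Longrightarrow> G (x \<circ> \<pi>) = G x"
    and int: "integrable (lebesgue_n n) (\<lambda>x. unordered_weight \<alpha> n x * G x)"
  shows "(\<integral>x. lue_weight \<alpha> n x * G x \<partial>lebesgue_n n)
    = (\<integral>x. unordered_weight \<alpha> n x * G x \<partial>lebesgue_n n) / fact n"
proof -
  let ?S = "{\<pi>. \<pi> permutes {1..n}}"
  let ?I = "\<integral>x. lue_weight \<alpha> n x * G x \<partial>lebesgue_n n"
  have int': "integrable (lebesgue_n n) (\<lambda>x. lue_weight \<alpha> n x * G x)"
    unfolding lue_weight_eq
  proof (rule Bochner_Integration.integrable_bound[OF int])
    show "(\<lambda>x. indicator (ordered_region n) x * unordered_weight \<alpha> n x * G x)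
        \<in> borel_measurable (lebesgue_n n)"
      using G by measurable
  qed (simp add: indicator_def abs_mult)
  have "has_bochner_integral (lebesgue_n n) (\<lambda>x. \<Sum>\<pi>\<in>?S. lue_weight \<alpha> n (x \<circ> \<pi>) * G (x \<circ> \<pi>)) (\<Sum>\<pi>\<in>?S. ?I)"
    by (intro has_bochner_integral_sum has_bochner_integral_PiM_permute[where f="\<lambda>x. lue_weight \<alpha> n x * G x"])
      (use int' in \<open>auto simp: lborel.sigma_finite_measure_axioms\<close>)
  moreover have "(\<Sum>\<pi>\<in>?S. lue_weight \<alpha> n (x \<circ> \<pi>) * G (x \<circ> \<pi>)) = unordered_weight \<alpha> n x * G x" for x
  proof -
    have "(\<Sum>\<pi>\<in>?S. lue_weight \<alpha> n (x \<circ> \<pi>) * G (x \<circ> \<pi>)) = (\<Sum>\<pi>\<in>?S. lue_weight \<alpha> n (x \<circ> \<pi>) * G x)"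
      using sym by (intro sum.cong) auto
    then show ?thesis by (simp only: sum_distrib_right[symmetric] sum_lue_weight_permute)
  qed
  ultimately show ?thesis
    by (simp add: has_bochner_integral_iff card_permutations)
qed

section \<open>Moments of the ensemble\<close>

text \<open>Any monic family gives the same determinant; the Laguerre family is chosen for its
  orthogonality. Matrix indices start at 0 and coordinates at 1, hence \<open>Suc j\<close>.\<close>

lemma discriminant_eq_det_sq:
  "discriminant n x = (det (mat n n (\<lambda>(i, j). poly (monic_laguerre \<alpha> i) (x (Suc j)))))\<^sup>2"
proof -
  have "discriminant n x = (\<Prod>i=1..n. \<Prod>j=i+1..n. (x j - x i)\<^sup>2)"
    by (simp add: discriminant_def power2_commute)
  also have "\<dots> = (\<Prod>(i, j)\<in>Sigma {1..n} (\<lambda>i. {i+1..n}). (x j - x i)\<^sup>2)"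
    by (rule prod.Sigma) auto
  also have "\<dots> = (\<Prod>(j, i)\<in>Sigma {..<n} (\<lambda>j. {..<j}). (x (Suc j) - x (Suc i))\<^sup>2)"
    by (rule prod.reindex_bij_witness[of _ "\<lambda>(j, i). (Suc i, Suc j)" "\<lambda>(i, j). (j - 1, i - 1)"]) auto
  also have "\<dots> = (\<Prod>j<n. \<Prod>i<j. (x (Suc j) - x (Suc i))\<^sup>2)"
    by (rule prod.Sigma[symmetric]) auto
  also have "\<dots> = (det (mat n n (\<lambda>(i, j). poly (monic_laguerre \<alpha> i) (x (Suc j)))))\<^sup>2"
    using vandermonde_monic[of "monic_laguerre \<alpha>" n "\<lambda>j. x (Suc j)",
      OF degree_monic_laguerre lead_coeff_monic_laguerre]
    by (simp add: prod_power_distrib)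
  finally show ?thesis .
qed

lemma discriminant_eq_leibniz_sum_sq:
  "discriminant n x = (\<Sum>\<sigma> | \<sigma> permutes {0..<n}. of_int (sign \<sigma>) *
     (\<Prod>i=1..n. poly (monic_laguerre \<alpha> (\<sigma> (i - 1))) (x i)))\<^sup>2"
proof -
  define A where "A = mat n n (\<lambda>(i, j). poly (monic_laguerre \<alpha> i) (x (Suc j)))"
  have carrier: "A \<in> carrier_mat n n" by (simp add: A_def)
  have entry: "(\<Prod>j<n. A $$ (\<sigma> j, j)) = (\<Prod>i=1..n. poly (monic_laguerre \<alpha> (\<sigma> (i - 1))) (x i))"
    if "\<sigma> permutes {0..<n}" for \<sigma>
  proof -
    have "(\<Prod>j<n. A $$ (\<sigma> j, j)) = (\<Prod>j<n. poly (monic_laguerre \<alpha> (\<sigma> j)) (x (Suc j)))"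
    proof (rule prod.cong[OF refl])
      fix j assume "j \<in> {..<n}"
      moreover have "\<sigma> j < n" using calculation permutes_in_image[OF that, of j] by simp
      ultimately show "A $$ (\<sigma> j, j) = poly (monic_laguerre \<alpha> (\<sigma> j)) (x (Suc j))"
        by (simp add: A_def)
    qed
    also have "\<dots> = (\<Prod>i=1..n. poly (monic_laguerre \<alpha> (\<sigma> (i - 1))) (x i))"
      by (rule prod.reindex_bij_witness[of _ "\<lambda>i. i - 1" Suc]) auto
    finally show ?thesis .
  qed
  have "det A = (\<Sum>\<sigma> | \<sigma> permutes {0..<n}. of_int (sign \<sigma>) * (\<Prod>j<n. A $$ (\<sigma> j, j)))"
    by (rule det_col[OF carrier])
  also have "\<dots> = (\<Sum>\<sigma> | \<sigma> permutes {0..<n}. of_int (sign \<sigma>) *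
     (\<Prod>i=1..n. poly (monic_laguerre \<alpha> (\<sigma> (i - 1))) (x i)))"
    by (rule sum.cong[OF refl]) (simp only: entry mem_Collect_eq)
  finally show ?thesis
    unfolding discriminant_eq_det_sq[of n x \<alpha>] A_def[symmetric] by (rule arg_cong)
qed

text \<open>The insertion of x^s in coordinate k alone keeps the weight a product. The squared
  Leibniz sum becomes a double sum over \<sigma> and \<tau> of products of one-dimensional
  integrals, and only \<sigma> = \<tau> survives.\<close>

lemma has_bochner_integral_shifted_unordered_weight:
  assumes \<alpha>: "\<alpha> > -1" and s: "\<alpha> + s > -1" and k: "k \<in> {1..n}"
  shows "has_bochner_integral (lebesgue_n n)
    (\<lambda>x. (\<Prod>i=1..n. laguerre_weight (if i = k then \<alpha> + s else \<alpha>) (x i)) * discriminant n x)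
    ((\<Prod>j<n. laguerre_sq_norm \<alpha> j) *
      (\<Sum>\<sigma> | \<sigma> permutes {0..<n}. laguerre_moment \<alpha> s (\<sigma> (k - 1))))"
proof -
  let ?S = "{\<sigma>. \<sigma> permutes {0..<n}}" and ?L = "monic_laguerre \<alpha>"
  define \<beta> where "\<beta> i = (if i = k then \<alpha> + s else \<alpha>)" for i
  define F where "F \<sigma> \<tau> i t = laguerre_weight (\<beta> i) t * poly (?L (\<sigma> (i - 1)) * ?L (\<tau> (i - 1))) t"
    for \<sigma> \<tau> :: "nat \<Rightarrow> nat" and i t
  interpret product_sigma_finite "\<lambda>_::nat. lborel :: real measure" ..
  have \<beta>: "\<beta> i > -1" for i using \<alpha> s by (simp add: \<beta>_def)
  have F_int: "integrable lborel (F \<sigma> \<tau> i)" for \<sigma> \<tau> i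
    unfolding F_def by (rule integrable_laguerre_weight_poly[OF \<beta>])
  have F_eq: "integral\<^sup>L lborel (F \<sigma> \<tau> i)
      = laguerre_functional (\<beta> i) (?L (\<sigma> (i - 1)) * ?L (\<tau> (i - 1)))" for \<sigma> \<tau> i
    by (simp only: F_def[abs_def] laguerre_functional_def)
  have "has_bochner_integral (lebesgue_n n) (\<lambda>x. \<Prod>i=1..n. F \<sigma> \<tau> i (x i))
      (\<Prod>i=1..n. integral\<^sup>L lborel (F \<sigma> \<tau> i))" for \<sigma> \<tau>
    unfolding has_bochner_integral_iff
    by (intro conjI product_integrable_prod product_integral_prod F_int) auto
  then have "has_bochner_integral (lebesgue_n n)
      (\<lambda>x. \<Sum>\<sigma>\<in>?S. \<Sum>\<tau>\<in>?S. of_int (sign \<sigma> * sign \<tau>) * (\<Prod>i=1..n. F \<sigma> \<tau> i (x i)))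
      (\<Sum>\<sigma>\<in>?S. \<Sum>\<tau>\<in>?S. of_int (sign \<sigma> * sign \<tau>) * (\<Prod>i=1..n. integral\<^sup>L lborel (F \<sigma> \<tau> i)))"
    by (intro has_bochner_integral_sum has_bochner_integral_mult_right)
  moreover have "(\<Sum>\<sigma>\<in>?S. \<Sum>\<tau>\<in>?S. of_int (sign \<sigma> * sign \<tau>) * (\<Prod>i=1..n. F \<sigma> \<tau> i (x i)))
      = (\<Prod>i=1..n. laguerre_weight (\<beta> i) (x i)) * discriminant n x" for x
  proof -
    let ?W = "\<Prod>i=1..n. laguerre_weight (\<beta> i) (x i)"
    define P where "P \<sigma> = (\<Prod>i=1..n. poly (?L (\<sigma> (i - 1))) (x i))" for \<sigma>
    have "(\<Prod>i=1..n. F \<sigma> \<tau> i (x i)) = ?W * (P \<sigma> * P \<tau>)" for \<sigma> \<tau>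
      by (simp add: F_def P_def prod.distrib mult.assoc)
    then have "(\<Sum>\<sigma>\<in>?S. \<Sum>\<tau>\<in>?S. of_int (sign \<sigma> * sign \<tau>) * (\<Prod>i=1..n. F \<sigma> \<tau> i (x i)))
        = (\<Sum>\<sigma>\<in>?S. \<Sum>\<tau>\<in>?S. ?W * (of_int (sign \<sigma>) * P \<sigma> * (of_int (sign \<tau>) * P \<tau>)))"
      by (intro sum.cong refl) simp
    also have "\<dots> = ?W * ((\<Sum>\<sigma>\<in>?S. of_int (sign \<sigma>) * P \<sigma>) * (\<Sum>\<tau>\<in>?S. of_int (sign \<tau>) * P \<tau>))"
      by (simp only: sum_distrib_left[symmetric] sum_distrib_right[symmetric])
    finally show ?thesis
      unfolding discriminant_eq_leibniz_sum_sq[of n x \<alpha>] P_def power2_eq_square .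
  qed
  moreover have "(\<Sum>\<tau>\<in>?S. of_int (sign \<sigma> * sign \<tau>) * (\<Prod>i=1..n. integral\<^sup>L lborel (F \<sigma> \<tau> i)))
      = (\<Prod>j<n. laguerre_sq_norm \<alpha> j) * laguerre_moment \<alpha> s (\<sigma> (k - 1))" if \<sigma>: "\<sigma> \<in> ?S" for \<sigma>
  proof -
    have off: "(\<Prod>i=1..n. integral\<^sup>L lborel (F \<sigma> \<tau> i)) = 0" if \<tau>: "\<tau> \<in> ?S" "\<tau> \<noteq> \<sigma>" for \<tau>
    proof -
      \<comment> \<open>Orthogonality fails in the shifted coordinate k. Distinct permutations still
        differ at some other place, since agreeing everywhere but at one point forces agreement
        there too.\<close>
      have "\<exists>j<n. j \<noteq> k - 1 \<and> \<sigma> j \<noteq> \<tau> j"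
      proof (rule ccontr)
        assume "\<not> ?thesis"
        then have agree: "\<sigma> j = \<tau> j" if "j \<noteq> k - 1" for j
          using that \<sigma> \<tau> by (cases "j < n") (auto simp: permutes_not_in)
        have "\<sigma> (k - 1) = \<tau> (k - 1)"
          using \<sigma> \<tau> agree by (metis mem_Collect_eq permutes_inj permutes_surj injD surjD)
        with agree have "\<tau> = \<sigma>" by (metis ext)
        with \<tau> show False by simp
      qed
      then obtain j where j: "j < n" "j \<noteq> k - 1" "\<sigma> j \<noteq> \<tau> j" by blast
      then have "integral\<^sup>L lborel (F \<sigma> \<tau> (Suc j)) = 0"
        using monic_laguerre_orthogonal[OF \<alpha>] by (auto simp: F_eq \<beta>_def)
      then show ?thesis using j by (intro prod_zero) (auto intro!: bexI[of _ "Suc j"])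
    qed
    have moment: "laguerre_functional (\<alpha> + s) (?L j * ?L j) = laguerre_sq_norm \<alpha> j * laguerre_moment \<alpha> s j" for j
      using laguerre_sq_norm_pos[OF \<alpha>, of j] by (simp add: laguerre_moment_def power2_eq_square)
    have "(\<Sum>\<tau>\<in>?S. of_int (sign \<sigma> * sign \<tau>) * (\<Prod>i=1..n. integral\<^sup>L lborel (F \<sigma> \<tau> i)))
        = (\<Sum>\<tau>\<in>{\<sigma>}. of_int (sign \<sigma> * sign \<tau>) * (\<Prod>i=1..n. integral\<^sup>L lborel (F \<sigma> \<tau> i)))"
      using \<sigma> off by (intro sum.mono_neutral_right) (auto simp: finite_permutations simp del: prod_zero_iff)
    also have "\<dots> = (\<Prod>i=1..n. integral\<^sup>L lborel (F \<sigma> \<sigma> i))" by simp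
    also have "\<dots> = (\<Prod>i=1..n. laguerre_sq_norm \<alpha> (\<sigma> (i - 1)) *
        (if i = k then laguerre_moment \<alpha> s (\<sigma> (k - 1)) else 1))"
      by (intro prod.cong) (auto simp: F_eq \<beta>_def moment laguerre_sq_norm_def power2_eq_square)
    also have "\<dots> = (\<Prod>i=1..n. laguerre_sq_norm \<alpha> (\<sigma> (i - 1))) * laguerre_moment \<alpha> s (\<sigma> (k - 1))"
      using k by (simp add: prod.distrib)
    also have "(\<Prod>i=1..n. laguerre_sq_norm \<alpha> (\<sigma> (i - 1))) = (\<Prod>j\<in>{0..<n}. laguerre_sq_norm \<alpha> (\<sigma> j))"
      by (rule prod.reindex_bij_witness[of _ Suc "\<lambda>i. i - 1"]) auto
    also have "\<dots> = (\<Prod>j<n. laguerre_sq_norm \<alpha> j)"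
      using prod.permute[of \<sigma> "{0..<n}" "laguerre_sq_norm \<alpha>"] \<sigma>
      by (simp add: o_def atLeast0LessThan)
    finally show ?thesis .
  qed
  ultimately show ?thesis
    by (simp add: \<beta>_def sum_distrib_left)
qed

section \<open>Normalizing constant, expectation and conclusion\<close>

text \<open>This is the case s = 0, k = 1 of the shifted integral, where every moment equals 1 and
  the sum counts permutations.\<close>

lemma has_bochner_integral_unordered_weight:
  assumes "\<alpha> > -1" "n \<ge> 1"
  shows "has_bochner_integral (lebesgue_n n) (unordered_weight \<alpha> n)
    (fact n * (\<Prod>j<n. laguerre_sq_norm \<alpha> j))"
proof -
  have "laguerre_moment \<alpha> 0 j = 1" for j
    using laguerre_sq_norm_pos[OF assms(1), of j] by (simp add: laguerre_moment_def laguerre_sq_norm_def)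
  then show ?thesis
    using has_bochner_integral_shifted_unordered_weight[of \<alpha> 0 1 n] assms
    by (simp add: unordered_weight_def[abs_def] card_permutations mult.commute cong: if_cong)
qed

lemma has_bochner_integral_unordered_weight_sqrt:
  assumes \<alpha>: "\<alpha> > -1"
  shows "has_bochner_integral (lebesgue_n n) (\<lambda>x. unordered_weight \<alpha> n x * (\<Sum>k=1..n. sqrt (x k)))
    (fact n * (\<Prod>j<n. laguerre_sq_norm \<alpha> j) * (\<Sum>j<n. laguerre_moment \<alpha> (1 / 2) j))"
proof -
  let ?S = "{\<sigma>. \<sigma> permutes {0..<n}}" and ?a = "laguerre_moment \<alpha> (1 / 2)"
  have weight: "laguerre_weight \<alpha> t * sqrt t = laguerre_weight (\<alpha> + 1 / 2) t" for t
    by (cases "t \<ge> 0")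
      (auto simp: powr_add powr_half_sqrt laguerre_weight_def)
  have "(\<Prod>i=1..n. laguerre_weight (if i = k then \<alpha> + 1 / 2 else \<alpha>) (x i)) * discriminant n x
      = unordered_weight \<alpha> n x * sqrt (x k)" if "k \<in> {1..n}" for k x
  proof -
    have "(\<Prod>i=1..n. laguerre_weight (if i = k then \<alpha> + 1 / 2 else \<alpha>) (x i))
        = (\<Prod>i=1..n. laguerre_weight \<alpha> (x i) * (if i = k then sqrt (x k) else 1))"
      by (intro prod.cong) (auto simp: weight)
    also have "\<dots> = (\<Prod>i=1..n. laguerre_weight \<alpha> (x i)) * sqrt (x k)"
      using that by (simp add: prod.distrib)
    finally show ?thesis by (simp add: unordered_weight_def)
  qed
  then have "has_bochner_integral (lebesgue_n n) (\<lambda>x. unordered_weight \<alpha> n x * sqrt (x k))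
      ((\<Prod>j<n. laguerre_sq_norm \<alpha> j) * (\<Sum>\<sigma>\<in>?S. ?a (\<sigma> (k - 1))))" if "k \<in> {1..n}" for k
    using has_bochner_integral_shifted_unordered_weight[OF \<alpha>, of "1 / 2" k n] \<alpha> that by simp
  then have "has_bochner_integral (lebesgue_n n) (\<lambda>x. \<Sum>k=1..n. unordered_weight \<alpha> n x * sqrt (x k))
      (\<Sum>k=1..n. (\<Prod>j<n. laguerre_sq_norm \<alpha> j) * (\<Sum>\<sigma>\<in>?S. ?a (\<sigma> (k - 1))))"
    by (intro has_bochner_integral_sum)
  \<comment> \<open>For fixed \<sigma>, letting k vary meets every polynomial index once, so each of
    the n! permutations contributes the full sum.\<close>
  moreover have "(\<Sum>k=1..n. \<Sum>\<sigma>\<in>?S. ?a (\<sigma> (k - 1))) = fact n * (\<Sum>j<n. ?a j)"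
  proof -
    have "(\<Sum>k=1..n. ?a (\<sigma> (k - 1))) = (\<Sum>j<n. ?a j)" if "\<sigma> \<in> ?S" for \<sigma>
    proof -
      have "(\<Sum>k=1..n. ?a (\<sigma> (k - 1))) = (\<Sum>j\<in>{0..<n}. ?a (\<sigma> j))"
        by (rule sum.reindex_bij_witness[of _ Suc "\<lambda>i. i - 1"]) auto
      then show ?thesis
        using sum.permute[of \<sigma> "{0..<n}" ?a] that by (simp add: o_def atLeast0LessThan)
    qed
    then show ?thesis
      by (subst sum.swap) (simp add: card_permutations)
  qed
  ultimately show ?thesis
    unfolding sum_distrib_left[symmetric] by (simp only: mult_ac)
qed

lemma C_eq_sum_laguerre_moment:
  assumes \<alpha>: "\<alpha> > -1" and n: "n \<ge> 1"
  shows "C \<alpha> n = (\<Sum>j<n. laguerre_moment \<alpha> (1 / 2) j) / real n powr (3 / 2)"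
proof -
  let ?G = "\<lambda>x. \<Sum>k=1..n. sqrt (x k)" and ?H = "\<Prod>j<n. laguerre_sq_norm \<alpha> j"
  have sym: "?G (x \<circ> \<pi>) = ?G x" if "\<pi> permutes {1..n}" for x \<pi>
    using sum.permute[OF that, of "\<lambda>k. sqrt (x k)"] by (simp add: o_def)
  have G: "?G \<in> borel_measurable (lebesgue_n n)" by measurable
  have H: "?H > 0" using laguerre_sq_norm_pos[OF \<alpha>] by (intro prod_pos) auto
  \<comment> \<open>The n! from integrating over all orderings cancels against the n! from
    symmetrization, here and in \<open>E\<close>.\<close>
  have Z: "lue_Z \<alpha> n = ?H"
    using integral_lue_weight_symmetric[of "\<lambda>_. 1" n \<alpha>] has_bochner_integral_unordered_weight[OF \<alpha> n]
    by (simp add: lue_Z_def has_bochner_integral_iff)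
  have E: "(\<integral>x. lue_weight \<alpha> n x * ?G x \<partial>lebesgue_n n) = ?H * (\<Sum>j<n. laguerre_moment \<alpha> (1 / 2) j)"
    using integral_lue_weight_symmetric[OF G sym] has_bochner_integral_unordered_weight_sqrt[OF \<alpha>, of n]
    by (simp add: has_bochner_integral_iff)
  have lue_nonneg: "0 \<le> lue_density \<alpha> n x" for x
    unfolding lue_density_def Z lue_weight_eq using H unordered_weight_nonneg[of \<alpha> n x] by simp
  have meas: "lue_density \<alpha> n \<in> borel_measurable (lebesgue_n n)"
    unfolding lue_density_def[abs_def] lue_weight_eq by measurable
  have "(\<integral>x. ?G x \<partial>lue \<alpha> n) = (\<integral>x. lue_density \<alpha> n x * ?G x \<partial>lebesgue_n n)"
    unfolding lue_def using lue_nonneg by (intro integral_real_density meas G) auto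
  also have "\<dots> = (\<integral>x. lue_weight \<alpha> n x * ?G x \<partial>lebesgue_n n) / lue_Z \<alpha> n"
    by (simp add: lue_density_def)
  also have "\<dots> = (\<Sum>j<n. laguerre_moment \<alpha> (1 / 2) j)"
    unfolding E Z by (rule nonzero_mult_div_cancel_left) (use H in \<open>rule less_imp_neq[THEN not_sym]\<close>)
  finally show ?thesis by (simp add: C_def)
qed

theorem theorem1p1:
  fixes \<alpha> :: real and n :: nat
  assumes "\<alpha> \<ge> 0" and "n \<ge> 1"
  shows "C \<alpha> (n + 1) < C \<alpha> n"
proof -
  let ?M = "\<lambda>n. \<Sum>j<n. laguerre_moment \<alpha> (1 / 2) j"
  have \<alpha>: "\<alpha> > -1" "\<alpha> + 1 / 2 > -1" using assms by auto
  have "?M (n + 1) / real (n + 1) powr (3 / 2) < ?M n / real n powr (3 / 2)"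
  proof (rule discrete_euler_ratio_decreasing[OF \<open>\<alpha> \<ge> 0\<close>])
    show "?M m > 0" if "m \<ge> 1" for m
      using that laguerre_moment_pos[OF \<alpha>] by (intro sum_pos) (auto simp: lessThan_empty_iff)
    \<comment> \<open>At s = 1/2 the factor s (s + 1) is 3/4.\<close>
    show "real m * (real m + \<alpha>) * (?M (m + 1) - 2 * ?M m + ?M (m - 1)) = 3 / 4 * ?M m" if "m \<ge> 1" for m
      using laguerre_moment_sum_recurrence[OF \<alpha> that] by simp
  qed (use assms in auto)
  with assms \<alpha> show ?thesis by (simp add: C_eq_sum_laguerre_moment del: sum.lessThan_Suc)
qed

end
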